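(* Let $\mathcal{G}_1$ and $\mathcal{G}_2$ be graphcodes (with the same label range $\{1,\ldots,m\}\times\{1,\ldots,m+1\}\times\{1,\ldots,n\}$) that are disjoint as graphs. Then $PM(\mathcal{G}_1\sqcup\mathcal{G}_2)=PM(\mathcal{G}_1)\oplus PM(\mathcal{G}_2)$.
   Context: $G(m,n)$ is the poset $\{1,\ldots,m\}\times\{1,\ldots,n\}$ with the product order. A persistence module is a functor $M\colon G(m,n)\to\mathbf{Vec}$ into finite-dimensional vector spaces over $\mathbb{Z}_2$; morphisms are natural transformations. Fixing the second coordinate to $i$ gives the slice $M_{(-,i)}\colon G(m,1)\to\mathbf{Vec}$, a one-parameter persistence module; the maps of $M$ from second coordinate $i$ to $i+1$ form a morphism $M_{(-,i)}\to M_{(-,i+1)}$. In this way a two-parameter module is the same as a functor $G(1,n)\to\mathbf{Vec}^{G(m,1)}$, i.e. a sequence of one-parameter modules with connecting morphisms. For integers $1\le b<d\le m+1$, the one-parameter interval module $[b,d)\colon G(m,1)\to\mathbf{Vec}$ is $\mathbb{Z}_2$ at all $x$ with $b\le x<d$, zero elsewhere, with identity maps inside the interval. For intervals $I=[b_1,d_1)$, $J=[b_2,d_2)$ write $J\lhd I$ if $b_2\le b_1<d_2\le d_1$. Then $\mathrm{Hom}(I,J)\cong\mathbb{Z}_2$ if $J\lhd I$ and $\mathrm{Hom}(I,J)=0$ otherwise; so there is at most one non-zero morphism $I\to J$, denoted $1$, and morphisms between direct sums of intervals are described by matrices over $\mathbb{Z}_2$ (with rows indexed by target summands and columns by source summands).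 A graphcode is a directed graph $\mathcal{G}=(V,E,c)$ with vertex labels $c\colon V\to\{1,\ldots,m\}\times\{1,\ldots,m+1\}\times\{1,\ldots,n\}$, $c(v)=(b(v),d(v),h(v))$, such that (1) $b(v)<d(v)$ for all $v\in V$; (2) for every edge $(v,w)\in E$, $h(w)=h(v)+1$ and $[b(w),d(w))\lhd[b(v),d(v))$. The persistence module $PM(\mathcal{G})$ induced by a graphcode $\mathcal{G}$ is the two-parameter module with slices $PM(\mathcal{G})_{(-,i)}=\bigoplus_{v:\,h(v)=i}[b(v),d(v))$ and connecting morphism from slice $i$ to slice $i+1$ given by the matrix $\eta^i$ with columns indexed by the vertices $v$ with $h(v)=i$, rows by the vertices $w$ with $h(w)=i+1$, and entry $\eta^i_{wv}=1$ if $(v,w)\in E$ and $0$ otherwise. Direct sums are understood without regard to the order of the summands. *)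

theory Defs
  imports
    "Jordan_Normal_Form.VS_Connect"
    "Graph_Theory.Pair_Digraph"
    "HOL-Library.Z2"
begin

hide_const (open) Multiset.mult Polynomial.smult

abbreviation Z2 :: "bit ring" where
  "Z2 \<equiv> class_ring"

section \<open>Persistence modules over a poset\<close>

text \<open>
  A persistence module is a functor from a poset (carrier \<open>P\<close>, order \<open>leq\<close>) to finite-dimensional
  vector spaces over the field with two elements. Every object carries its own vector space
  structure; only the type \<open>'a\<close> of vectors is common to all objects.
  Linear maps are HOL functions whose values outside the source carrier are irrelevant, so that
  identities of linear maps are required on the carrier only.
\<close>

record ('p, 'a) pmod =
  pm_space :: "'p \<Rightarrow> (bit, 'a) module"
  pm_map :: "'p \<Rightarrow> 'p \<Rightarrow> 'a \<Rightarrow> 'a"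

definition persistence_module ::
    "'p set \<Rightarrow> ('p \<Rightarrow> 'p \<Rightarrow> bool) \<Rightarrow> ('p, 'a) pmod \<Rightarrow> bool" where
  "persistence_module P leq M \<longleftrightarrow>
     (\<forall>p\<in>P. vectorspace Z2 (pm_space M p) \<and> vectorspace.fin_dim Z2 (pm_space M p)) \<and>
     (\<forall>p\<in>P. \<forall>q\<in>P. leq p q \<longrightarrow> linear_map Z2 (pm_space M p) (pm_space M q) (pm_map M p q)) \<and>
     (\<forall>p\<in>P. \<forall>u\<in>carrier (pm_space M p). pm_map M p p u = u) \<and>
     (\<forall>p\<in>P. \<forall>q\<in>P. \<forall>r\<in>P. leq p q \<longrightarrow> leq q r \<longrightarrow>
        (\<forall>u\<in>carrier (pm_space M p). pm_map M q r (pm_map M p q u) = pm_map M p r u))"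

definition pm_morphism ::
    "'p set \<Rightarrow> ('p \<Rightarrow> 'p \<Rightarrow> bool) \<Rightarrow> ('p, 'a) pmod \<Rightarrow> ('p, 'b) pmod \<Rightarrow> ('p \<Rightarrow> 'a \<Rightarrow> 'b) \<Rightarrow> bool" where
  "pm_morphism P leq M N \<phi> \<longleftrightarrow>
     persistence_module P leq M \<and> persistence_module P leq N \<and>
     (\<forall>p\<in>P. linear_map Z2 (pm_space M p) (pm_space N p) (\<phi> p)) \<and>
     (\<forall>p\<in>P. \<forall>q\<in>P. leq p q \<longrightarrow>
        (\<forall>u\<in>carrier (pm_space M p). \<phi> q (pm_map M p q u) = pm_map N p q (\<phi> p u)))"

definition pm_isomorphism ::
    "'p set \<Rightarrow> ('p \<Rightarrow> 'p \<Rightarrow> bool) \<Rightarrow> ('p, 'a) pmod \<Rightarrow> ('p, 'b) pmod \<Rightarrow> ('p \<Rightarrow> 'a \<Rightarrow> 'b) \<Rightarrow> bool" where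
  "pm_isomorphism P leq M N \<phi> \<longleftrightarrow>
     pm_morphism P leq M N \<phi> \<and>
     (\<forall>p\<in>P. bij_betw (\<phi> p) (carrier (pm_space M p)) (carrier (pm_space N p)))"

definition pm_sum :: "('p, 'a) pmod \<Rightarrow> ('p, 'b) pmod \<Rightarrow> ('p, 'a \<times> 'b) pmod" (infixl "\<oplus>\<^sub>p\<^sub>m" 65) where
  "M \<oplus>\<^sub>p\<^sub>m N =
     \<lparr> pm_space = (\<lambda>p. direct_sum (pm_space M p) (pm_space N p)),
       pm_map = (\<lambda>p q. map_prod (pm_map M p q) (pm_map N p q)) \<rparr>"

text \<open>
  The direct sum of a finite family of vector spaces, indexed by a set and hence without any order
  of the summands. The ring components \<open>mult\<close> and \<open>one\<close> of the record type \<open>module\<close> play no role.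
\<close>

definition family_sum :: "'i set \<Rightarrow> ('i \<Rightarrow> (bit, 'a) module) \<Rightarrow> (bit, 'i \<Rightarrow> 'a) module" where
  "family_sum I V =
     \<lparr> carrier = (\<Pi>\<^sub>E i\<in>I. carrier (V i)),
       mult = (\<lambda>f g. \<lambda>i\<in>I. \<zero>\<^bsub>V i\<^esub>),
       one = (\<lambda>i\<in>I. \<zero>\<^bsub>V i\<^esub>),
       zero = (\<lambda>i\<in>I. \<zero>\<^bsub>V i\<^esub>),
       add = (\<lambda>f g. \<lambda>i\<in>I. f i \<oplus>\<^bsub>V i\<^esub> g i),
       smult = (\<lambda>a f. \<lambda>i\<in>I. a \<odot>\<^bsub>V i\<^esub> f i) \<rparr>"

definition pm_family_sum :: "'i set \<Rightarrow> ('i \<Rightarrow> ('p, 'a) pmod) \<Rightarrow> ('p, 'i \<Rightarrow> 'a) pmod" where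
  "pm_family_sum I M =
     \<lparr> pm_space = (\<lambda>p. family_sum I (\<lambda>i. pm_space (M i) p)),
       pm_map = (\<lambda>p q f. \<lambda>i\<in>I. pm_map (M i) p q (f i)) \<rparr>"


section \<open>Interval modules and their morphisms\<close>

text \<open>
  One-parameter modules are indexed by the chain \<open>{1..m}\<close> of natural numbers; the pair \<open>(b, d)\<close>
  represents the interval \<open>[b, d)\<close>.
\<close>

abbreviation in_interval :: "nat \<Rightarrow> nat \<times> nat \<Rightarrow> bool" where
  "in_interval x I \<equiv> fst I \<le> x \<and> x < snd I"

definition interval_module :: "nat \<times> nat \<Rightarrow> (nat, bit) pmod" where
  "interval_module I =
     \<lparr> pm_space = (\<lambda>x. \<lparr> carrier = (if in_interval x I then UNIV else {0}),
                        mult = (*), one = 1, zero = 0, add = (+), smult = (*) \<rparr>),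
       pm_map = (\<lambda>x y a. if in_interval x I \<and> in_interval y I then a else 0) \<rparr>"

definition interval_rel :: "nat \<times> nat \<Rightarrow> nat \<times> nat \<Rightarrow> bool" (infix "\<lhd>\<^sub>i" 50) where
  "J \<lhd>\<^sub>i I \<longleftrightarrow> fst J \<le> fst I \<and> fst I < snd J \<and> snd J \<le> snd I"

text \<open>
  The component at \<open>x\<close> of the unique non-zero morphism from \<open>I\<close> to \<open>J\<close> if \<open>J \<lhd>\<^sub>i I\<close>, and of the
  zero morphism otherwise.
\<close>

definition unit_morphism :: "nat \<times> nat \<Rightarrow> nat \<times> nat \<Rightarrow> nat \<Rightarrow> bit \<Rightarrow> bit" where
  "unit_morphism I J x a = (if J \<lhd>\<^sub>i I \<and> in_interval x I \<and> in_interval x J then a else 0)"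

text \<open>
  The component at \<open>x\<close> of the morphism between the direct sums of the intervals \<open>I v\<close>, \<open>v \<in> A\<close>, and
  \<open>I w\<close>, \<open>w \<in> B\<close>, given by a matrix \<open>\<eta>\<close> with rows \<open>w\<close> and columns \<open>v\<close>.
\<close>

definition matrix_morphism ::
    "('v \<Rightarrow> nat \<times> nat) \<Rightarrow> 'v set \<Rightarrow> 'v set \<Rightarrow> ('v \<Rightarrow> 'v \<Rightarrow> bit) \<Rightarrow> nat \<Rightarrow> ('v \<Rightarrow> bit) \<Rightarrow> ('v \<Rightarrow> bit)" where
  "matrix_morphism I A B \<eta> x f =
     (\<lambda>w\<in>B. \<Sum>v\<in>A. \<eta> w v * unit_morphism (I v) (I w) x (f v))"


section \<open>Two-parameter modules from sequences of one-parameter modules\<close>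

definition grid :: "nat \<Rightarrow> nat \<Rightarrow> (nat \<times> nat) set" where
  "grid m n = {1..m} \<times> {1..n}"

definition grid_le :: "nat \<times> nat \<Rightarrow> nat \<times> nat \<Rightarrow> bool" where
  "grid_le p q \<longleftrightarrow> fst p \<le> fst q \<and> snd p \<le> snd q"

text \<open>
  \<open>iterate_connect \<eta> x i k\<close> is the composite at \<open>x\<close> of the connecting morphisms
  \<open>\<eta> i, \<eta> (i + 1), \<dots>, \<eta> (i + k - 1)\<close>, from slice \<open>i\<close> to slice \<open>i + k\<close>.
\<close>

primrec iterate_connect :: "(nat \<Rightarrow> nat \<Rightarrow> 'a \<Rightarrow> 'a) \<Rightarrow> nat \<Rightarrow> nat \<Rightarrow> nat \<Rightarrow> 'a \<Rightarrow> 'a" where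
  "iterate_connect \<eta> x i 0 = id"
| "iterate_connect \<eta> x i (Suc k) = \<eta> (i + k) x \<circ> iterate_connect \<eta> x i k"

definition two_parameter ::
    "(nat \<Rightarrow> (nat, 'a) pmod) \<Rightarrow> (nat \<Rightarrow> nat \<Rightarrow> 'a \<Rightarrow> 'a) \<Rightarrow> (nat \<times> nat, 'a) pmod" where
  "two_parameter S \<eta> =
     \<lparr> pm_space = (\<lambda>(x, i). pm_space (S i) x),
       pm_map = (\<lambda>(x, i) (y, j). pm_map (S j) x y \<circ> iterate_connect \<eta> x i (j - i)) \<rparr>"


section \<open>Graphcodes\<close>

record 'v graphcode = "'v pair_pre_digraph" +
  label :: "'v \<Rightarrow> nat \<times> nat \<times> nat"

definition birth :: "'v graphcode \<Rightarrow> 'v \<Rightarrow> nat" where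
  "birth G v = fst (label G v)"

definition death :: "'v graphcode \<Rightarrow> 'v \<Rightarrow> nat" where
  "death G v = fst (snd (label G v))"

definition height :: "'v graphcode \<Rightarrow> 'v \<Rightarrow> nat" where
  "height G v = snd (snd (label G v))"

definition bar :: "'v graphcode \<Rightarrow> 'v \<Rightarrow> nat \<times> nat" where
  "bar G v = (birth G v, death G v)"

text \<open>
  Graphs are finite, which is what makes the induced modules pointwise finite-dimensional.
\<close>

definition graphcode :: "nat \<Rightarrow> nat \<Rightarrow> 'v graphcode \<Rightarrow> bool" where
  "graphcode m n G \<longleftrightarrow>
     pair_fin_digraph (pair_pre_digraph.truncate G) \<and>
     (\<forall>v\<in>pverts G. label G v \<in> {1..m} \<times> {1..m+1} \<times> {1..n}) \<and>
     (\<forall>v\<in>pverts G. birth G v < death G v) \<and>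
     (\<forall>(v, w)\<in>parcs G. height G w = height G v + 1 \<and> bar G w \<lhd>\<^sub>i bar G v)"

text \<open>For graphs with disjoint vertex sets.\<close>

definition graphcode_union :: "'v graphcode \<Rightarrow> 'v graphcode \<Rightarrow> 'v graphcode" (infixl "\<squnion>\<^sub>g" 65) where
  "G \<squnion>\<^sub>g H =
     \<lparr> pverts = pverts G \<union> pverts H, parcs = parcs G \<union> parcs H,
       label = (\<lambda>v. if v \<in> pverts G then label G v else label H v) \<rparr>"

lemma graphcode_union:
  assumes "graphcode m n G" "graphcode m n H" "pverts G \<inter> pverts H = {}"
  shows "graphcode m n (G \<squnion>\<^sub>g H)"
proof -
  have G: "pair_fin_digraph (pair_pre_digraph.truncate G)"
    and H: "pair_fin_digraph (pair_pre_digraph.truncate H)"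
    using assms by (auto simp: graphcode_def)
  have wG: "v \<in> pverts G \<and> w \<in> pverts G" if "(v, w) \<in> parcs G" for v w
    using pair_wf_digraph.in_arcsD1[of "pair_pre_digraph.truncate G" v w]
      pair_wf_digraph.in_arcsD2[of "pair_pre_digraph.truncate G" v w] that G
    by (auto simp: pair_pre_digraph.defs pair_fin_digraph_def)
  have wH: "v \<in> pverts H \<and> w \<in> pverts H" if "(v, w) \<in> parcs H" for v w
    using pair_wf_digraph.in_arcsD1[of "pair_pre_digraph.truncate H" v w]
      pair_wf_digraph.in_arcsD2[of "pair_pre_digraph.truncate H" v w] that H
    by (auto simp: pair_pre_digraph.defs pair_fin_digraph_def)
  have nH: "v \<notin> pverts G" if "v \<in> pverts H" for v
    using assms(3) that by auto
  have fin: "finite (pverts G)" "finite (parcs G)" "finite (pverts H)" "finite (parcs H)"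
    using G H by (auto simp: pair_pre_digraph.defs pair_fin_digraph_def pair_fin_digraph_axioms_def)
  have "pair_fin_digraph (pair_pre_digraph.truncate (G \<squnion>\<^sub>g H))"
    by unfold_locales
      (use wG wH fin in \<open>auto simp: graphcode_union_def pair_pre_digraph.defs\<close>)
  moreover have "birth (G \<squnion>\<^sub>g H) v = (if v \<in> pverts G then birth G v else birth H v)"
    "death (G \<squnion>\<^sub>g H) v = (if v \<in> pverts G then death G v else death H v)"
    "height (G \<squnion>\<^sub>g H) v = (if v \<in> pverts G then height G v else height H v)" for v
    by (auto simp: graphcode_union_def birth_def death_def height_def)
  ultimately show ?thesis
    using assms(1,2) wG wH nH unfolding graphcode_def bar_def
    by (fastforce simp: graphcode_union_def)
qed

definition level :: "'v graphcode \<Rightarrow> nat \<Rightarrow> 'v set" where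
  "level G i = {v \<in> pverts G. height G v = i}"

definition slice :: "'v graphcode \<Rightarrow> nat \<Rightarrow> (nat, 'v \<Rightarrow> bit) pmod" where
  "slice G i = pm_family_sum (level G i) (\<lambda>v. interval_module (bar G v))"

definition edge_matrix :: "'v graphcode \<Rightarrow> 'v \<Rightarrow> 'v \<Rightarrow> bit" where
  "edge_matrix G w v = (if (v, w) \<in> parcs G then 1 else 0)"

definition connect :: "'v graphcode \<Rightarrow> nat \<Rightarrow> nat \<Rightarrow> ('v \<Rightarrow> bit) \<Rightarrow> ('v \<Rightarrow> bit)" where
  "connect G i = matrix_morphism (bar G) (level G i) (level G (Suc i)) (edge_matrix G)"

definition PM :: "'v graphcode \<Rightarrow> (nat \<times> nat, 'v \<Rightarrow> bit) pmod" where
  "PM G = two_parameter (slice G) (connect G)"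

text \<open>
  Reordering of summands: at \<open>(x, i)\<close>, the sum over the vertices of \<open>G \<squnion>\<^sub>g H\<close> of height \<open>i\<close> is
  regrouped into the sum over the vertices of \<open>G\<close> and the sum over those of \<open>H\<close>. On each single
  interval summand this is the identity onto the same summand of the target.
\<close>

definition regroup ::
    "'v graphcode \<Rightarrow> 'v graphcode \<Rightarrow> nat \<times> nat \<Rightarrow> ('v \<Rightarrow> bit) \<Rightarrow> ('v \<Rightarrow> bit) \<times> ('v \<Rightarrow> bit)" where
  "regroup G H = (\<lambda>(x, i) f. (restrict f (level G i), restrict f (level H i)))"

end

theory Submission
  imports Defs
begin

text \<open>
  The connecting matrices of \<open>PM (G \<squnion>\<^sub>g H)\<close> are block diagonal with respect to the splitting of each
  slice into the summands from \<open>G\<close> and those from \<open>H\<close>, because no edge joins the two graphs.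
  It is convenient to exploit only half of this at a time. If \<open>K\<close> is a subgraph of \<open>U\<close> that contains
  every edge of \<open>U\<close> ending in \<open>K\<close> together with its source, then the rows of the matrices of \<open>U\<close> at
  vertices of \<open>K\<close> vanish outside the columns of \<open>K\<close>, where they agree with the matrices of \<open>K\<close>.
  Hence forgetting the coordinates outside \<open>K\<close> commutes with all connecting maps and is a morphism
  \<open>PM U \<rightarrow> PM K\<close> (\<open>pm_morphism_restrict\<close>).

  Both \<open>G\<close> and \<open>H\<close> are such subgraphs of \<open>G \<squnion>\<^sub>g H\<close>, and \<open>regroup G H\<close> is the pair of the
  two projections, so it is a morphism into the direct sum (\<open>pm_morphism_into_sum\<close>). It is bijective at
  each grid point, since a family over a disjoint union of index sets is the same as a pair of families
  (\<open>bij_betw_restrict_Un\<close>).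

  Being a morphism includes that source and target are persistence modules. That \<open>PM G\<close> is one
  (\<open>persistence_module_PM\<close>) rests on two facts: a sequence of one-parameter modules and morphisms is a
  two-parameter module, and a matrix of interval morphisms is a morphism of one-parameter modules.
  The condition \<open>J \<lhd>\<^sub>i I\<close> on the entries enters in the second one.
\<close>

section \<open>Linear algebra over the field with two elements\<close>

text \<open>
  Addition and multiplication of bits are kept as ring operations, so that the ring laws apply to them
  rather than the rules for bitwise logic.
\<close>

declare mult_bit_eq_and [simp del] add_bit_eq_xor [simp del]

lemma bit_cases: "(a::bit) = 0 \<or> a = 1"
  by (cases a) auto

lemma finite_UNIV_bit: "finite (UNIV :: bit set)"
proof (rule finite_subset)
  show "(UNIV :: bit set) \<subseteq> {0, 1}"
    using bit_cases by auto
qed simp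

lemma vectorspace_Z2_smult:
  assumes "vectorspace Z2 V" "v \<in> carrier V"
  shows "(0::bit) \<odot>\<^bsub>V\<^esub> v = \<zero>\<^bsub>V\<^esub>" "(1::bit) \<odot>\<^bsub>V\<^esub> v = v"
proof -
  interpret vectorspace Z2 V by fact
  show "(0::bit) \<odot>\<^bsub>V\<^esub> v = \<zero>\<^bsub>V\<^esub>" using lmult_0[OF assms(2)] by simp
  show "(1::bit) \<odot>\<^bsub>V\<^esub> v = v" using smult_one[OF assms(2)] by simp
qed

text \<open>
  The only scalars are \<open>0\<close> and \<open>1\<close>. Multiplication by \<open>1\<close> is the identity, multiplication by \<open>0\<close> is
  constantly \<open>\<zero>\<close>, and an additive map preserves \<open>\<zero>\<close>; so homogeneity need never be checked.
\<close>

lemma linear_map_Z2_iff_additive: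
  "linear_map Z2 V W T \<longleftrightarrow>
     vectorspace Z2 V \<and> vectorspace Z2 W \<and> T \<in> carrier V \<rightarrow> carrier W \<and>
     (\<forall>u\<in>carrier V. \<forall>v\<in>carrier V. T (u \<oplus>\<^bsub>V\<^esub> v) = T u \<oplus>\<^bsub>W\<^esub> T v)" (is "_ \<longleftrightarrow> ?additive")
proof
  assume "linear_map Z2 V W T"
  then interpret linear_map Z2 V W T .
  show ?additive
    using V.vectorspace_axioms W.vectorspace_axioms by auto
next
  assume T: ?additive
  interpret V: vectorspace Z2 V using T by simp
  interpret W: vectorspace Z2 W using T by simp
  have "T \<zero>\<^bsub>V\<^esub> \<oplus>\<^bsub>W\<^esub> T \<zero>\<^bsub>V\<^esub> = T \<zero>\<^bsub>V\<^esub>"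
    using T V.zero_closed V.r_zero by metis
  then have T0: "T \<zero>\<^bsub>V\<^esub> = \<zero>\<^bsub>W\<^esub>"
    using T V.zero_closed W.add.r_cancel_one' by (metis Pi_iff)
  have "T (a \<odot>\<^bsub>V\<^esub> v) = a \<odot>\<^bsub>W\<^esub> T v" if v: "v \<in> carrier V" for a v
  proof -
    have "T v \<in> carrier W" using T v by auto
    then show ?thesis
      using bit_cases[of a] T T0 v by (auto simp: vectorspace_Z2_smult)
  qed
  then have "mod_hom Z2 V W T"
    using T V.module_axioms W.module_axioms
    by (auto simp: mod_hom_def mod_hom_axioms_def LinearCombinations.module_hom_def)
  then show "linear_map Z2 V W T"
    using T by (simp add: linear_map_def)
qed

text \<open>
  A finite generating set has finitely many linear combinations over a finite field, and conversely a
  finite space generates itself. This replaces every argument about bases by a count of vectors.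
\<close>

lemma fin_dim_Z2_iff_finite:
  assumes "vectorspace Z2 V"
  shows "vectorspace.fin_dim Z2 V \<longleftrightarrow> finite (carrier V)"
proof -
  interpret vectorspace Z2 V by fact
  show ?thesis
  proof
    assume fin_dim
    then obtain A where A: "finite A" "A \<subseteq> carrier V" "span A = carrier V"
      unfolding fin_dim_def by blast
    have "carrier V \<subseteq> (\<lambda>a. lincomb a A) ` (A \<rightarrow>\<^sub>E UNIV)"
    proof
      fix v assume "v \<in> carrier V"
      then obtain a where a: "lincomb a A = v"
        using finite_in_span[OF A(1,2), of v] A(3) by auto
      \<comment> \<open>Coefficient functions are cut down to \<open>A\<close>, since only the extensional ones form a finite set.\<close>
      have "lincomb (restrict a A) A = lincomb a A"
        by (rule lincomb_cong) (use A in auto)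
      then show "v \<in> (\<lambda>a. lincomb a A) ` (A \<rightarrow>\<^sub>E UNIV)"
        using a by (intro image_eqI[of _ _ "restrict a A"]) auto
    qed
    moreover have "finite (A \<rightarrow>\<^sub>E (UNIV :: bit set))"
      using A(1) finite_UNIV_bit by (intro finite_PiE)
    ultimately show "finite (carrier V)"
      by (meson finite_imageI finite_subset)
  next
    assume "finite (carrier V)"
    moreover have "span (carrier V) = carrier V"
      by (meson in_own_span order_antisym_conv span_is_subset2 subset_refl)
    ultimately show fin_dim
      unfolding fin_dim_def by blast
  qed
qed

lemma family_sum_simps [simp]:
  "carrier (family_sum I V) = (\<Pi>\<^sub>E i\<in>I. carrier (V i))"
  "\<zero>\<^bsub>family_sum I V\<^esub> = (\<lambda>i\<in>I. \<zero>\<^bsub>V i\<^esub>)"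
  "f \<oplus>\<^bsub>family_sum I V\<^esub> g = (\<lambda>i\<in>I. f i \<oplus>\<^bsub>V i\<^esub> g i)"
  "a \<odot>\<^bsub>family_sum I V\<^esub> f = (\<lambda>i\<in>I. a \<odot>\<^bsub>V i\<^esub> f i)"
  by (auto simp: family_sum_def)

lemma direct_sum_simps [simp]:
  "carrier (direct_sum V W) = carrier V \<times> carrier W"
  "u \<oplus>\<^bsub>direct_sum V W\<^esub> v = (fst u \<oplus>\<^bsub>V\<^esub> fst v, snd u \<oplus>\<^bsub>W\<^esub> snd v)"
  by (auto simp: direct_sum_def)

lemma vectorspace_family_sum:
  assumes "\<And>i. i \<in> I \<Longrightarrow> vectorspace Z2 (V i)"
  shows "vectorspace Z2 (family_sum I V)"
proof -
  have module: "Module.module Z2 (V i)" if "i \<in> I" for i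
    using assms[OF that] by (simp add: vectorspace_def)
  then have group: "abelian_group (V i)" if "i \<in> I" for i
    using that by (simp add: Module.module_def)
  note closed = abelian_monoid.zero_closed[OF abelian_group.axioms(1)]
    abelian_monoid.a_closed[OF abelian_group.axioms(1)] abelian_group.a_inv_closed
    module.smult_closed
  note laws = abelian_monoid.a_comm[OF abelian_group.axioms(1)]
    abelian_monoid.a_assoc[OF abelian_group.axioms(1)]
    abelian_monoid.r_zero[OF abelian_group.axioms(1)]
  have field: "field Z2"
    by (rule class_field.field_axioms)
  show ?thesis
  proof (rule vs_criteria[OF field], goal_cases)
    case 3
    show ?case
    proof
      fix f assume f: "f \<in> carrier (family_sum I V)"
      show "\<exists>g\<in>carrier (family_sum I V). f \<oplus>\<^bsub>family_sum I V\<^esub> g = \<zero>\<^bsub>family_sum I V\<^esub>"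
        by (rule bexI[of _ "\<lambda>i\<in>I. \<ominus>\<^bsub>V i\<^esub> f i"])
          (use f group in \<open>auto simp: PiE_iff extensional_def restrict_def fun_eq_iff
             intro: abelian_group.a_inv_closed abelian_group.r_neg\<close>)
    qed
  qed (use module group in \<open>auto simp: PiE_iff extensional_def restrict_def fun_eq_iff
        vectorspace_Z2_smult[OF assms]
        intro!: closed laws module.smult_l_distr[where R = Z2, simplified]
          module.smult_r_distr[where R = Z2, simplified] module.smult_assoc1[where R = Z2, simplified]\<close>)
qed

lemma finite_family_sum:
  assumes "finite I" "\<And>i. i \<in> I \<Longrightarrow> finite (carrier (V i))"
  shows "finite (carrier (family_sum I V))"
  using assms by (simp add: finite_PiE)


section \<open>Constructions of persistence modules\<close>

lemma persistence_module_additive_iff: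
  "persistence_module P leq M \<longleftrightarrow>
     (\<forall>p\<in>P. vectorspace Z2 (pm_space M p) \<and> finite (carrier (pm_space M p))) \<and>
     (\<forall>p\<in>P. \<forall>q\<in>P. leq p q \<longrightarrow>
        pm_map M p q \<in> carrier (pm_space M p) \<rightarrow> carrier (pm_space M q) \<and>
        (\<forall>u\<in>carrier (pm_space M p). \<forall>v\<in>carrier (pm_space M p).
           pm_map M p q (u \<oplus>\<^bsub>pm_space M p\<^esub> v) = pm_map M p q u \<oplus>\<^bsub>pm_space M q\<^esub> pm_map M p q v)) \<and>
     (\<forall>p\<in>P. \<forall>u\<in>carrier (pm_space M p). pm_map M p p u = u) \<and>
     (\<forall>p\<in>P. \<forall>q\<in>P. \<forall>r\<in>P. leq p q \<longrightarrow> leq q r \<longrightarrow>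
        (\<forall>u\<in>carrier (pm_space M p). pm_map M q r (pm_map M p q u) = pm_map M p r u))"
  unfolding persistence_module_def linear_map_Z2_iff_additive
  using fin_dim_Z2_iff_finite by blast

lemma persistence_module_sum:
  assumes "persistence_module P leq M" "persistence_module P leq N"
  shows "persistence_module P leq (M \<oplus>\<^sub>p\<^sub>m N)"
  using assms unfolding persistence_module_additive_iff pm_sum_def
  by (auto simp: direct_sum_is_vs Pi_iff)

lemma persistence_module_family_sum:
  assumes "finite I" and M: "\<And>i. i \<in> I \<Longrightarrow> persistence_module P leq (M i)"
  shows "persistence_module P leq (pm_family_sum I M)"
proof -
  have "vectorspace Z2 (family_sum I (\<lambda>i. pm_space (M i) p))" if "p \<in> P" for p
    by (rule vectorspace_family_sum)
      (use M that in \<open>auto simp: persistence_module_additive_iff\<close>)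
  moreover have "finite (carrier (family_sum I (\<lambda>i. pm_space (M i) p)))" if "p \<in> P" for p
    by (rule finite_family_sum)
      (use assms(1) M that in \<open>auto simp: persistence_module_additive_iff\<close>)
  moreover note M[unfolded persistence_module_additive_iff]
  ultimately show ?thesis
    unfolding persistence_module_additive_iff pm_family_sum_def
    by (auto simp: Pi_iff PiE_iff extensional_def restrict_def fun_eq_iff)
qed

lemma pm_morphism_additive_iff:
  "pm_morphism P leq M N \<phi> \<longleftrightarrow>
     persistence_module P leq M \<and> persistence_module P leq N \<and>
     (\<forall>p\<in>P. \<phi> p \<in> carrier (pm_space M p) \<rightarrow> carrier (pm_space N p) \<and>
        (\<forall>u\<in>carrier (pm_space M p). \<forall>v\<in>carrier (pm_space M p).
           \<phi> p (u \<oplus>\<^bsub>pm_space M p\<^esub> v) = \<phi> p u \<oplus>\<^bsub>pm_space N p\<^esub> \<phi> p v)) \<and>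
     (\<forall>p\<in>P. \<forall>q\<in>P. leq p q \<longrightarrow>
        (\<forall>u\<in>carrier (pm_space M p). \<phi> q (pm_map M p q u) = pm_map N p q (\<phi> p u)))"
  unfolding pm_morphism_def linear_map_Z2_iff_additive
  by (auto simp: persistence_module_def)

text \<open>
  One half of the universal property of the product.
\<close>

lemma pm_morphism_into_sum:
  assumes "pm_morphism P leq M N \<phi>" "pm_morphism P leq M N' \<psi>"
  shows "pm_morphism P leq M (N \<oplus>\<^sub>p\<^sub>m N') (\<lambda>p u. (\<phi> p u, \<psi> p u))"
  using assms persistence_module_sum[of P leq N N']
  unfolding pm_morphism_additive_iff by (auto simp: pm_sum_def Pi_iff)

lemma iterate_connect_add:
  "iterate_connect \<eta> x i (k + l) = iterate_connect \<eta> x (i + k) l \<circ> iterate_connect \<eta> x i k"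
  by (induction l) (auto simp: add.assoc)

lemma pm_morphism_id:
  assumes "persistence_module P leq M"
  shows "pm_morphism P leq M M (\<lambda>p u. u)"
  using assms by (auto simp: pm_morphism_additive_iff)

lemma pm_morphism_comp:
  assumes "pm_morphism P leq L M \<phi>" "pm_morphism P leq M N \<psi>"
  shows "pm_morphism P leq L N (\<lambda>p. \<psi> p \<circ> \<phi> p)"
  using assms by (auto simp: pm_morphism_additive_iff Pi_iff)

lemma pm_morphism_iterate_connect:
  assumes "\<And>j. i \<le> j \<Longrightarrow> j \<le> i + k \<Longrightarrow> persistence_module P leq (S j)"
    and "\<And>j. i \<le> j \<Longrightarrow> j < i + k \<Longrightarrow> pm_morphism P leq (S j) (S (Suc j)) (\<eta> j)"
  shows "pm_morphism P leq (S i) (S (i + k)) (\<lambda>x. iterate_connect \<eta> x i k)"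
  using assms
proof (induction k)
  case 0
  then show ?case by (simp add: pm_morphism_id id_def)
next
  case (Suc k)
  have "pm_morphism P leq (S i) (S (i + k)) (\<lambda>x. iterate_connect \<eta> x i k)"
    using Suc by simp
  moreover have "pm_morphism P leq (S (i + k)) (S (i + Suc k)) (\<eta> (i + k))"
    using Suc.prems(2)[of "i + k"] by simp
  ultimately show ?case
    unfolding iterate_connect.simps by (rule pm_morphism_comp)
qed

text \<open>
  The map from \<open>(x, i)\<close> to \<open>(y, j)\<close> first climbs from slice \<open>i\<close> to slice \<open>j\<close> at \<open>x\<close> and then moves from
  \<open>x\<close> to \<open>y\<close>. Composing two such maps gives climb, move, climb, move; naturality of the connecting
  morphisms exchanges the middle two steps, after which the climbs and the moves compose among themselves.
\<close>

lemma persistence_module_two_parameter: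
  assumes S: "\<And>i. i \<in> {1..n} \<Longrightarrow> persistence_module {1..m} (\<le>) (S i)"
    and \<eta>: "\<And>i. 1 \<le> i \<Longrightarrow> i < n \<Longrightarrow> pm_morphism {1..m} (\<le>) (S i) (S (Suc i)) (\<eta> i)"
  shows "persistence_module (grid m n) grid_le (two_parameter S \<eta>)"
proof -
  have iter: "pm_morphism {1..m} (\<le>) (S i) (S j) (\<lambda>x. iterate_connect \<eta> x i (j - i))"
    if "1 \<le> i" "i \<le> j" "j \<le> n" for i j
    using pm_morphism_iterate_connect[of i "j - i" "{1..m}" "(\<le>)" S \<eta>] S \<eta> that by auto
  have func: "pm_map (S l) y z (iterate_connect \<eta> y j (l - j)
                (pm_map (S j) x y (iterate_connect \<eta> x i (j - i) u))) =
              pm_map (S l) x z (iterate_connect \<eta> x i (l - i) u)"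
    if x: "1 \<le> x" "x \<le> y" "y \<le> z" "z \<le> m" and i: "1 \<le> i" "i \<le> j" "j \<le> l" "l \<le> n"
      and u: "u \<in> carrier (pm_space (S i) x)" for x y z i j l u
  proof -
    define v where "v = iterate_connect \<eta> x i (j - i) u"
    have v: "v \<in> carrier (pm_space (S j) x)"
      using iter[of i j] x i u unfolding v_def by (auto simp: pm_morphism_additive_iff)
    have w: "iterate_connect \<eta> x j (l - j) v \<in> carrier (pm_space (S l) x)"
      using iter[of j l] x i v by (auto simp: pm_morphism_additive_iff)
    have "iterate_connect \<eta> y j (l - j) (pm_map (S j) x y v) =
          pm_map (S l) x y (iterate_connect \<eta> x j (l - j) v)"
      using iter[of j l] x i v by (auto simp: pm_morphism_additive_iff)
    moreover have "iterate_connect \<eta> x i (l - i) u = iterate_connect \<eta> x j (l - j) v"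
      using iterate_connect_add[of \<eta> x i "j - i" "l - j"] i by (simp add: v_def)
    ultimately show ?thesis
      using S[of l] w x i unfolding v_def[symmetric] by (simp add: persistence_module_additive_iff)
  qed
  have pm_map: "pm_map (S j) x y \<circ> iterate_connect \<eta> x i (j - i)
                  \<in> carrier (pm_space (S i) x) \<rightarrow> carrier (pm_space (S j) y) \<and>
       (\<forall>u\<in>carrier (pm_space (S i) x). \<forall>v\<in>carrier (pm_space (S i) x).
         (pm_map (S j) x y \<circ> iterate_connect \<eta> x i (j - i)) (u \<oplus>\<^bsub>pm_space (S i) x\<^esub> v) =
         (pm_map (S j) x y \<circ> iterate_connect \<eta> x i (j - i)) u \<oplus>\<^bsub>pm_space (S j) y\<^esub>
         (pm_map (S j) x y \<circ> iterate_connect \<eta> x i (j - i)) v)"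
    if "1 \<le> x" "x \<le> y" "y \<le> m" "1 \<le> i" "i \<le> j" "j \<le> n" for x y i j
    using iter[of i j] S[of j] that
    by (auto simp: pm_morphism_additive_iff persistence_module_additive_iff Pi_iff)
  show ?thesis
    unfolding persistence_module_additive_iff
    using S pm_map func
    by (auto simp: two_parameter_def grid_def grid_le_def persistence_module_additive_iff)
qed


section \<open>The persistence module of a graphcode\<close>

lemma persistence_module_interval: "persistence_module P (\<le>) (interval_module I)"
proof -
  have "\<exists>b. a + b = 0" for a :: bit
    by (rule exI[of _ "- a"]) (rule add.right_inverse)
  then have "vectorspace Z2 (pm_space (interval_module I) x)" for x
    by (intro vs_criteria[OF class_field.field_axioms])
      (auto simp: interval_module_def algebra_simps)
  then show ?thesis
    by (auto simp: persistence_module_additive_iff interval_module_def finite_UNIV_bit)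
qed

text \<open>
  Naturality is checked entrywise. If \<open>x \<le> y\<close> and both composites \<open>I \<rightarrow> J\<close> from \<open>x\<close> to \<open>y\<close> are to
  agree, it must be excluded that \<open>x\<close> lies in \<open>I\<close> but not in \<open>J\<close> while \<open>y\<close> lies in both, and that \<open>x\<close>
  lies in both while \<open>y\<close> lies in \<open>J\<close> but not in \<open>I\<close>. For \<open>J \<lhd>\<^sub>i I\<close> the former is impossible because
  \<open>J\<close> is born no later than \<open>I\<close>, the latter because \<open>J\<close> dies no later than \<open>I\<close>. If \<open>J \<lhd>\<^sub>i I\<close> fails,
  the entry is the zero morphism, whatever the coefficient \<open>\<eta>\<close>.
\<close>

lemma pm_morphism_matrix_morphism:
  assumes "finite A" "finite B"
  shows "pm_morphism P (\<le>) (pm_family_sum A (\<lambda>v. interval_module (I v)))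
           (pm_family_sum B (\<lambda>w. interval_module (I w))) (matrix_morphism I A B \<eta>)"
proof -
  have unit: "unit_morphism I J x (a + b) = unit_morphism I J x a + unit_morphism I J x b"
    for I J x a b by (simp add: unit_morphism_def)
  have zero: "unit_morphism I J x a = 0" if "\<not> in_interval x J" for I J x a
    using that by (auto simp: unit_morphism_def)
  have nat: "unit_morphism I J y (if in_interval x I \<and> in_interval y I then a else 0) =
        (if in_interval x J \<and> in_interval y J then unit_morphism I J x a else 0)"
    if "x \<le> y" for I J x y a
    using that by (auto simp: unit_morphism_def interval_rel_def)
  have closed: "(\<Sum>v\<in>A. \<eta> w v * unit_morphism (I v) (I w) x (f v))
      \<in> carrier (pm_space (interval_module (I w)) x)" for w x f
    by (auto simp: interval_module_def zero)
  have additive: "matrix_morphism I A B \<eta> x (\<lambda>v\<in>A. f v + g v) =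
      (\<lambda>w\<in>B. matrix_morphism I A B \<eta> x f w + matrix_morphism I A B \<eta> x g w)" for x f g
    by (auto simp: matrix_morphism_def unit algebra_simps sum.distrib fun_eq_iff restrict_def
        cong: sum.cong)
  have natural: "matrix_morphism I A B \<eta> y
        (\<lambda>v\<in>A. if in_interval x (I v) \<and> in_interval y (I v) then f v else 0) =
      (\<lambda>w\<in>B. if in_interval x (I w) \<and> in_interval y (I w)
             then matrix_morphism I A B \<eta> x f w else 0)" if "x \<le> y" for x y f
  proof
    fix w
    have "(\<Sum>v\<in>A. \<eta> w v * unit_morphism (I v) (I w) y
        ((\<lambda>v\<in>A. if in_interval x (I v) \<and> in_interval y (I v) then f v else 0) v)) =
      (\<Sum>v\<in>A. \<eta> w v * (if in_interval x (I w) \<and> in_interval y (I w)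
        then unit_morphism (I v) (I w) x (f v) else 0))"
      using nat[OF that] by (intro sum.cong) simp_all
    then show "matrix_morphism I A B \<eta> y
        (\<lambda>v\<in>A. if in_interval x (I v) \<and> in_interval y (I v) then f v else 0) w =
      (\<lambda>w\<in>B. if in_interval x (I w) \<and> in_interval y (I w)
             then matrix_morphism I A B \<eta> x f w else 0) w"
      by (auto simp: matrix_morphism_def)
  qed
  let ?M = "pm_family_sum A (\<lambda>v. interval_module (I v))"
  let ?N = "pm_family_sum B (\<lambda>w. interval_module (I w))"
  have "persistence_module P (\<le>) ?M" "persistence_module P (\<le>) ?N"
    using assms by (simp_all add: persistence_module_family_sum persistence_module_interval)
  moreover have "matrix_morphism I A B \<eta> x f \<in> carrier (pm_space ?N x)" for x f
    unfolding matrix_morphism_def using closed by (simp add: pm_family_sum_def restrict_PiE_iff)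
  moreover have "matrix_morphism I A B \<eta> x (f \<oplus>\<^bsub>pm_space ?M x\<^esub> g) =
      matrix_morphism I A B \<eta> x f \<oplus>\<^bsub>pm_space ?N x\<^esub> matrix_morphism I A B \<eta> x g" for x f g
    using additive[of x f g] by (simp add: pm_family_sum_def interval_module_def)
  moreover have "matrix_morphism I A B \<eta> y (pm_map ?M x y f) =
      pm_map ?N x y (matrix_morphism I A B \<eta> x f)" if "x \<le> y" for x y f
    using natural[OF that, of f] by (simp add: pm_family_sum_def interval_module_def)
  ultimately show ?thesis
    unfolding pm_morphism_additive_iff by blast
qed

lemma finite_level:
  assumes "graphcode m n G"
  shows "finite (level G i)"
  using assms
  by (auto simp: graphcode_def pair_fin_digraph_def pair_fin_digraph_axioms_def
      pair_pre_digraph.defs level_def)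

lemma persistence_module_PM:
  assumes "graphcode m n G"
  shows "persistence_module (grid m n) grid_le (PM G)"
  unfolding PM_def
  by (rule persistence_module_two_parameter)
    (auto simp: slice_def connect_def finite_level[OF assms]
      intro!: persistence_module_family_sum persistence_module_interval pm_morphism_matrix_morphism)

lemma arc_ends:
  assumes "graphcode m n G" "(v, w) \<in> parcs G"
  shows "v \<in> pverts G" "w \<in> pverts G"
  using assms pair_wf_digraph.in_arcsD1[of "pair_pre_digraph.truncate G" v w]
      pair_wf_digraph.in_arcsD2[of "pair_pre_digraph.truncate G" v w]
  by (auto simp: pair_pre_digraph.defs pair_fin_digraph_def graphcode_def)


section \<open>Projection onto a predecessor-closed subgraph\<close>

text \<open>
  Edges of \<open>U\<close> from \<open>K\<close> to the outside are permitted: they leave the rows at vertices of \<open>K\<close> untouched.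
  Closure under predecessors is encoded in the last conjunct, as the source of an edge of \<open>K\<close> is a
  vertex of \<open>K\<close> in every graphcode.
\<close>

definition predecessor_closed :: "'v graphcode \<Rightarrow> 'v graphcode \<Rightarrow> bool" where
  "predecessor_closed K U \<longleftrightarrow>
     pverts K \<subseteq> pverts U \<and> (\<forall>v\<in>pverts K. label K v = label U v) \<and>
     (\<forall>v. \<forall>w\<in>pverts K. (v, w) \<in> parcs U \<longleftrightarrow> (v, w) \<in> parcs K)"

context
  fixes m n :: nat and K U :: "'v graphcode"
  assumes K: "graphcode m n K" and U: "graphcode m n U" and KU: "predecessor_closed K U"
begin

lemma bar_subgraph: "v \<in> pverts K \<Longrightarrow> bar U v = bar K v"
  using KU by (auto simp: predecessor_closed_def bar_def birth_def death_def)

lemma level_subgraph: "level K i = level U i \<inter> pverts K"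
  using KU by (auto simp: predecessor_closed_def level_def height_def)

text \<open>
  With the vertices of \<open>K\<close> separated from the others, the matrix of \<open>U\<close> is block triangular, and the
  matrix of \<open>K\<close> is one of its diagonal blocks.
\<close>

lemma restrict_connect:
  "restrict (connect U i x f) (level K (Suc i)) = connect K i x (restrict f (level K i))"
proof
  fix w
  show "restrict (connect U i x f) (level K (Suc i)) w = connect K i x (restrict f (level K i)) w"
  proof (cases "w \<in> level K (Suc i)")
    case True
    then have w: "w \<in> pverts K" "w \<in> level U (Suc i)"
      by (auto simp: level_subgraph)
    have edge: "(v, w) \<in> parcs U \<longleftrightarrow> (v, w) \<in> parcs K" for v
      using KU w(1) by (simp add: predecessor_closed_def)
    have "(\<Sum>v\<in>level U i. edge_matrix U w v * unit_morphism (bar U v) (bar U w) x (f v)) =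
          (\<Sum>v\<in>level K i. edge_matrix K w v * unit_morphism (bar K v) (bar K w) x (restrict f (level K i) v))"
      \<comment> \<open>A vertex outside \<open>K\<close> has no edge to \<open>w\<close>, so its column contributes nothing to row \<open>w\<close>.\<close>
    proof (rule sum.mono_neutral_cong_right)
      show "finite (level U i)" by (rule finite_level[OF U])
    qed (use w arc_ends(1)[OF K] in \<open>auto simp: level_subgraph bar_subgraph edge edge_matrix_def\<close>)
    then show ?thesis
      using True w by (simp add: connect_def matrix_morphism_def)
  qed (simp add: connect_def matrix_morphism_def)
qed

lemma restrict_iterate_connect:
  "restrict (iterate_connect (connect U) x i k f) (level K (i + k)) =
     iterate_connect (connect K) x i k (restrict f (level K i))"
proof (induction k)
  case (Suc k)
  then show ?case
    by (simp only: iterate_connect.simps o_apply add_Suc_right restrict_connect)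
qed simp

lemma pm_morphism_restrict:
  "pm_morphism (grid m n) grid_le (PM U) (PM K) (\<lambda>(x, i) f. restrict f (level K i))"
proof -
  have slice_map: "restrict (pm_map (slice U j) x y f) (level K j) =
      pm_map (slice K j) x y (restrict f (level K j))" for x y j f
    by (auto simp: slice_def pm_family_sum_def interval_module_def bar_subgraph level_subgraph
        fun_eq_iff restrict_def)
  have natural: "restrict (pm_map (PM U) (x, i) (y, j) f) (level K j) =
      pm_map (PM K) (x, i) (y, j) (restrict f (level K i))"
    if "i \<le> j" for x y i j f
    using restrict_iterate_connect[of x i "j - i" f] that
    by (simp add: PM_def two_parameter_def slice_map)
  have space: "pm_space (PM G) (x, i) =
      family_sum (level G i) (\<lambda>v. pm_space (interval_module (bar G v)) x)" for G :: "'v graphcode" and x i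
    by (simp add: PM_def two_parameter_def slice_def pm_family_sum_def)
  have "bar K v = bar U v" "v \<in> level U i" if "v \<in> level K i" for v i
    using that by (auto simp: level_subgraph bar_subgraph)
  then have "(\<lambda>f. restrict f (level K i)) \<in> carrier (pm_space (PM U) (x, i)) \<rightarrow> carrier (pm_space (PM K) (x, i)) \<and>
      (\<forall>f\<in>carrier (pm_space (PM U) (x, i)). \<forall>g\<in>carrier (pm_space (PM U) (x, i)).
        restrict (f \<oplus>\<^bsub>pm_space (PM U) (x, i)\<^esub> g) (level K i) =
        restrict f (level K i) \<oplus>\<^bsub>pm_space (PM K) (x, i)\<^esub> restrict g (level K i))" for x i
    by (auto simp: space PiE_iff restrict_def fun_eq_iff)
  then show ?thesis
    using persistence_module_PM[OF K] persistence_module_PM[OF U] natural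
    unfolding pm_morphism_additive_iff by (auto simp: grid_le_def)
qed

end


section \<open>Regrouping the summands of a disjoint union\<close>

lemma bij_betw_restrict_Un:
  assumes "A \<inter> B = {}"
  shows "bij_betw (\<lambda>f. (restrict f A, restrict f B)) (Pi\<^sub>E (A \<union> B) C) (Pi\<^sub>E A C \<times> Pi\<^sub>E B C)"
proof (rule bij_betw_byWitness[where f' = "\<lambda>(g, h) v. if v \<in> A then g v else h v"])
qed (use assms in \<open>auto simp: PiE_iff extensional_def restrict_def fun_eq_iff\<close>)

theorem proposition2:
  fixes G1 G2 :: "'v graphcode" and m n :: nat
  assumes "graphcode m n G1"
    and "graphcode m n G2"
    and "pverts G1 \<inter> pverts G2 = {}"
  shows "pm_isomorphism (grid m n) grid_le (PM (G1 \<squnion>\<^sub>g G2)) (PM G1 \<oplus>\<^sub>p\<^sub>m PM G2) (regroup G1 G2)"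
proof -
  let ?U = "G1 \<squnion>\<^sub>g G2"
  have U: "graphcode m n ?U"
    using assms by (rule graphcode_union)
  have closed: "predecessor_closed G1 ?U" "predecessor_closed G2 ?U"
    using assms(3) arc_ends(2)[OF assms(1)] arc_ends(2)[OF assms(2)]
    by (auto simp: predecessor_closed_def graphcode_union_def disjoint_iff)
  have "regroup G1 G2 = (\<lambda>p f. ((\<lambda>(x, i) f. restrict f (level G1 i)) p f,
                                (\<lambda>(x, i) f. restrict f (level G2 i)) p f))"
    by (auto simp: regroup_def fun_eq_iff)
  then have "pm_morphism (grid m n) grid_le (PM ?U) (PM G1 \<oplus>\<^sub>p\<^sub>m PM G2) (regroup G1 G2)"
    using pm_morphism_into_sum[OF pm_morphism_restrict[OF assms(1) U closed(1)]
        pm_morphism_restrict[OF assms(2) U closed(2)]] by simp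
  moreover have "bij_betw (regroup G1 G2 (x, i)) (carrier (pm_space (PM ?U) (x, i)))
      (carrier (pm_space (PM G1 \<oplus>\<^sub>p\<^sub>m PM G2) (x, i)))" for x i
  proof -
    let ?C = "\<lambda>v. carrier (pm_space (interval_module (bar ?U v)) x)"
    have "level ?U i = level G1 i \<union> level G2 i"
      using level_subgraph[OF assms(1) U closed(1)] level_subgraph[OF assms(2) U closed(2)]
      by (auto simp: level_def graphcode_union_def)
    then have source: "carrier (pm_space (PM ?U) (x, i)) = Pi\<^sub>E (level G1 i \<union> level G2 i) ?C"
      by (simp add: PM_def two_parameter_def slice_def pm_family_sum_def)
    have "bar ?U v = bar G1 v" if "v \<in> level G1 i" for v
      using that bar_subgraph[OF assms(1) U closed(1)] by (auto simp: level_def)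
    moreover have "bar ?U v = bar G2 v" if "v \<in> level G2 i" for v
      using that bar_subgraph[OF assms(2) U closed(2)] by (auto simp: level_def)
    ultimately have target: "carrier (pm_space (PM G1 \<oplus>\<^sub>p\<^sub>m PM G2) (x, i)) =
        Pi\<^sub>E (level G1 i) ?C \<times> Pi\<^sub>E (level G2 i) ?C"
      by (simp add: PM_def two_parameter_def slice_def pm_family_sum_def pm_sum_def cong: PiE_cong)
    have "level G1 i \<inter> level G2 i = {}"
      using assms(3) by (auto simp: level_def)
    then show ?thesis
      unfolding source target regroup_def by (simp add: bij_betw_restrict_Un)
  qed
  ultimately show ?thesis
    by (auto simp: pm_isomorphism_def)
qed

end
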